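(* Let $X$ be a set and let $\rho$ be an $R_0$ topology on $X$ such that $X$ is the union of infinitely many pairwise disjoint point closures $cl_\rho(x)$. Then there are no minimal presober members of $\mathcal{L}_\rho$; that is, there is no presober $\tau\in\mathcal{L}_\rho$ such that no member of $\mathcal{L}_\rho$ strictly contained in $\tau$ is presober.
   Context: Topologies on $X$ are ordered by inclusion ($\leq$ means $\subseteq$). For a topology $\tau$, $cl_\tau(A)$ is the $\tau$-closure of $A$ and $cl_\tau(x)=cl_\tau(\{x\})$ (a point closure). $\tau$ is $R_0$ if for all $x,y\in X$, $x\in cl_\tau(y)$ iff $y\in cl_\tau(x)$ (equivalently, the point closures partition $X$). For a topology $\rho$ on $X$, $\mathcal{L}_\rho=\{\tau : \tau \text{ a topology on } X,\ at(\rho)\leq\tau\leq\overline{\rho}\}$, where $at(\rho)$ is the topology generated by the sets $X\setminus cl_\rho(H)$ with $H\subseteq X$ finite, and $\overline{\rho}$ is the closure of $\rho$ in $2^X=\{0,1\}^X$ with the product topology (sets identified with characteristic functions); $\overline\rho$ is the smallest topology containing $\rho$ that is closed under arbitrary intersections, i.e. the family of all sets that are intersections of $\rho$-open sets. A nonempty closed set $C$ is reducible if $C=C_1\cup C_2$ for some nonempty closed proper subsets $C_1,C_2$ of $C$; otherwise it is irreducible ($\emptyset$ is neither). A topology $\tau$ is presober if every irreducible closed set $C$ has at least one generic point, i.e. $C=cl_\tau(x)$ for some $x$. *)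

theory Defs
  imports "HOL-Analysis.Analysis"
begin

definition R0_space :: "'a topology \<Rightarrow> bool" where
  "R0_space \<tau> \<longleftrightarrow>
    (\<forall>x\<in>topspace \<tau>. \<forall>y\<in>topspace \<tau>.
      x \<in> \<tau> closure_of {y} \<longleftrightarrow> y \<in> \<tau> closure_of {x})"

definition point_closures :: "'a topology \<Rightarrow> 'a set set" where
  "point_closures \<tau> = (\<lambda>x. \<tau> closure_of {x}) ` topspace \<tau>"

definition at_topology :: "'a topology \<Rightarrow> 'a topology" where
  "at_topology \<rho> =
    topology_generated_by {topspace \<rho> - \<rho> closure_of H |H. finite H \<and> H \<subseteq> topspace \<rho>}"

text \<open>
  A subset \<open>A\<close> of \<open>X\<close> is identified with the point \<open>\<lambda>x\<in>X. x \<in> A\<close> of the product of \<open>X\<close>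
  copies of the two-point discrete space, here \<^typ>\<open>bool\<close>.
\<close>

definition cantor_cube :: "'a set \<Rightarrow> ('a \<Rightarrow> bool) topology" where
  "cantor_cube X = product_topology (\<lambda>_. discrete_topology (UNIV :: bool set)) X"

definition char_fun :: "'a set \<Rightarrow> 'a set \<Rightarrow> 'a \<Rightarrow> bool" where
  "char_fun X A = (\<lambda>x\<in>X. x \<in> A)"

definition closure_in_cube :: "'a topology \<Rightarrow> 'a set set" where
  "closure_in_cube \<rho> =
    {A. A \<subseteq> topspace \<rho> \<and>
        char_fun (topspace \<rho>) A \<in>
          cantor_cube (topspace \<rho>) closure_of (char_fun (topspace \<rho>) ` {U. openin \<rho> U})}"

definition topology_interval :: "'a topology \<Rightarrow> 'a topology set" where
  "topology_interval \<rho> =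
    {\<tau>. topspace \<tau> = topspace \<rho> \<and>
        {U. openin (at_topology \<rho>) U} \<subseteq> {U. openin \<tau> U} \<and>
        {U. openin \<tau> U} \<subseteq> closure_in_cube \<rho>}"

definition irreducible_closedin :: "'a topology \<Rightarrow> 'a set \<Rightarrow> bool" where
  "irreducible_closedin \<tau> C \<longleftrightarrow>
    closedin \<tau> C \<and> C \<noteq> {} \<and>
    \<not> (\<exists>C1 C2. closedin \<tau> C1 \<and> closedin \<tau> C2 \<and> C1 \<noteq> {} \<and> C2 \<noteq> {} \<and>
              C1 \<subset> C \<and> C2 \<subset> C \<and> C = C1 \<union> C2)"

definition presober :: "'a topology \<Rightarrow> bool" where
  "presober \<tau> \<longleftrightarrow>
    (\<forall>C. irreducible_closedin \<tau> C \<longrightarrow> (\<exists>x\<in>topspace \<tau>. C = \<tau> closure_of {x}))"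

text \<open>The closure in the cube is the family of intersections of open sets; the intersection
  of no sets, which is \<open>X\<close>, is covered by \<open>\<F> = {X}\<close>.\<close>

lemma char_fun_in_closure_iff:
  "char_fun X A \<in> cantor_cube X closure_of (char_fun X ` \<U>) \<longleftrightarrow>
    (\<forall>F. finite F \<and> F \<subseteq> X \<longrightarrow> (\<exists>U\<in>\<U>. U \<inter> F = A \<inter> F))" (is "?L \<longleftrightarrow> ?R")
proof
  assume L: ?L
  show ?R
  proof (intro allI impI)
    fix F assume F: "finite F \<and> F \<subseteq> X"
    define T where "T = PiE X (\<lambda>x. if x \<in> F then {x \<in> A} else UNIV)"
    have "openin (cantor_cube X) T"
      unfolding cantor_cube_def T_def
      by (rule product_topology_basis) (use F in \<open>auto intro: finite_subset[of _ F]\<close>)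
    moreover have "char_fun X A \<in> T"
      by (auto simp: T_def char_fun_def)
    ultimately obtain U where U: "U \<in> \<U>" "char_fun X U \<in> T"
      using L unfolding in_closure_of by blast
    have "x \<in> U \<longleftrightarrow> x \<in> A" if "x \<in> F" for x
    proof -
      have "x \<in> X" using F that by auto
      then have "char_fun X U x \<in> {x \<in> A}"
        using U(2) that unfolding T_def by (auto dest: PiE_mem)
      then show ?thesis using \<open>x \<in> X\<close> by (simp add: char_fun_def)
    qed
    then show "\<exists>U\<in>\<U>. U \<inter> F = A \<inter> F" using U(1) by blast
  qed
next
  assume R: ?R
  show ?L
    unfolding in_closure_of
  proof (intro conjI allI impI)
    show "char_fun X A \<in> topspace (cantor_cube X)"
      by (simp add: cantor_cube_def char_fun_def)
    fix T assume T: "char_fun X A \<in> T \<and> openin (cantor_cube X) T"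
    then obtain V where V: "finite {i \<in> X. V i \<noteq> UNIV}"
      "char_fun X A \<in> PiE X V" "PiE X V \<subseteq> T"
      unfolding cantor_cube_def openin_product_topology_alt by auto
    obtain U where U: "U \<in> \<U>" "U \<inter> {i \<in> X. V i \<noteq> UNIV} = A \<inter> {i \<in> X. V i \<noteq> UNIV}"
      using R V(1) by (metis (no_types, lifting) mem_Collect_eq subsetI)
    have "char_fun X U \<in> PiE X V"
    proof (rule PiE_I)
      fix x assume x: "x \<in> X"
      show "char_fun X U x \<in> V x"
      proof (cases "V x = UNIV")
        case False
        then have "(x \<in> U) = (x \<in> A)" using U(2) x by blast
        then have "char_fun X U x = char_fun X A x" by (simp add: char_fun_def)
        then show ?thesis using PiE_mem[OF V(2) x] by simp
      qed simp
    qed (simp add: char_fun_def)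
    then show "\<exists>y. y \<in> char_fun X ` \<U> \<and> y \<in> T" using U(1) V(3) by blast
  qed
qed

lemma closure_in_cube_eq_Inter:
  "closure_in_cube \<rho> = {\<Inter>\<F> |\<F>. \<F> \<noteq> {} \<and> (\<forall>U\<in>\<F>. openin \<rho> U)}" (is "_ = ?I")
proof (rule set_eqI)
  fix A
  let ?X = "topspace \<rho>"
  have mem: "A \<in> closure_in_cube \<rho> \<longleftrightarrow>
      A \<subseteq> ?X \<and> (\<forall>F. finite F \<and> F \<subseteq> ?X \<longrightarrow> (\<exists>U. openin \<rho> U \<and> U \<inter> F = A \<inter> F))"
    unfolding closure_in_cube_def char_fun_in_closure_iff by auto
  show "A \<in> closure_in_cube \<rho> \<longleftrightarrow> A \<in> ?I"
  proof
    assume "A \<in> closure_in_cube \<rho>"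
    then have AX: "A \<subseteq> ?X"
      and sep: "\<And>F. finite F \<Longrightarrow> F \<subseteq> ?X \<Longrightarrow> \<exists>U. openin \<rho> U \<and> U \<inter> F = A \<inter> F"
      using mem by auto
    define \<F> where "\<F> = {U. openin \<rho> U \<and> A \<subseteq> U}"
    have "?X \<in> \<F>" using AX by (simp add: \<F>_def)
    moreover have "y \<in> A" if y: "y \<in> \<Inter>\<F>" for y
    proof (rule ccontr)
      assume yA: "y \<notin> A"
      have yX: "y \<in> ?X" using y \<open>?X \<in> \<F>\<close> by blast
      have "\<exists>U. openin \<rho> U \<and> x \<in> U \<and> y \<notin> U" if "x \<in> A" for x
      proof -
        obtain U where "openin \<rho> U" "U \<inter> {x, y} = A \<inter> {x, y}"
          using sep[of "{x, y}"] that yX AX by auto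
        then show ?thesis using that yA by blast
      qed
      then obtain f where f: "\<And>x. x \<in> A \<Longrightarrow> openin \<rho> (f x) \<and> x \<in> f x \<and> y \<notin> f x"
        by metis
      then have "(\<Union>x\<in>A. f x) \<in> \<F>" by (auto simp: \<F>_def)
      then show False using y f by blast
    qed
    ultimately have "\<F> \<noteq> {}" "\<Inter>\<F> = A" by (auto simp: \<F>_def)
    then show "A \<in> ?I" by (auto simp: \<F>_def intro!: exI[of _ \<F>])
  next
    assume "A \<in> ?I"
    then obtain \<F> where \<F>: "\<F> \<noteq> {}" "\<And>U. U \<in> \<F> \<Longrightarrow> openin \<rho> U" "A = \<Inter>\<F>" by blast
    have "A \<subseteq> ?X" using \<F> openin_subset by blast
    moreover have "\<exists>U. openin \<rho> U \<and> U \<inter> F = A \<inter> F" if F: "finite F" "F \<subseteq> ?X" for F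
    proof -
      have "\<exists>U\<in>\<F>. x \<notin> U" if "x \<in> F - A" for x using that \<F>(3) by blast
      then obtain g where g: "\<And>x. x \<in> F - A \<Longrightarrow> g x \<in> \<F> \<and> x \<notin> g x" by metis
      obtain U0 where U0: "U0 \<in> \<F>" using \<F>(1) by blast
      have "openin \<rho> (\<Inter>(insert U0 (g ` (F - A))))"
        by (rule openin_Inter) (use F g U0 \<F>(2) in auto)
      moreover have "\<Inter>(insert U0 (g ` (F - A))) \<inter> F = A \<inter> F"
        using g U0 \<F>(3) by blast
      ultimately show ?thesis by blast
    qed
    ultimately show "A \<in> closure_in_cube \<rho>" using mem by blast
  qed
qed

lemma topspace_at_topology [simp]: "topspace (at_topology \<rho>) = topspace \<rho>"
proof -
  have "topspace \<rho> \<in> {topspace \<rho> - \<rho> closure_of H |H. finite H \<and> H \<subseteq> topspace \<rho>}"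
    by (auto intro!: exI[of _ "{}"])
  then show ?thesis
    unfolding at_topology_def topology_generated_by_topspace by blast
qed

end

theory Submission
  imports Defs
begin

text \<open>
  A topology in the interval of an \<open>R\<^sub>0\<close> topology \<open>\<rho>\<close> has the same point closures as \<open>\<rho>\<close>, and its
  closed sets are unions of these pairwise disjoint blocks. Up to collapsing every block to a point,
  the interval consists of all \<open>T\<^sub>1\<close> topologies on an infinite set, and a presober member is one in
  which no closed set with more than one block is irreducible. It remains to find, for every presober
  member \<open>\<tau>\<close>, a strictly coarser presober one.

  The coarser topology keeps, for a chosen point \<open>p\<close>, those \<open>\<tau>\<close>-closed sets that contain \<open>p\<close> or
  consist of finitely many blocks. Finite sets of blocks stay closed, so the result is still in the
  interval. It is presober because a splitting of a \<open>\<tau>\<close>-closed set survives when the block of \<open>p\<close> is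
  added to both parts; the only way in which this can fail is that one part consists of everything
  but the block of \<open>p\<close>, and then that part is itself split (lemma
  \<open>presober_coarsen_at\<close>). It is strictly coarser as soon as some \<open>\<tau>\<close>-closed set with
  infinitely many blocks misses \<open>p\<close>. Such a set and such a point exist because the whole space has
  infinitely many blocks and so splits into two proper closed subsets, at least one of which again
  has infinitely many blocks.
\<close>

section \<open>Point closures in the interval\<close>

lemma closedin_closure_of_finite_interval:
  assumes "\<tau> \<in> topology_interval \<rho>" "finite H" "H \<subseteq> topspace \<rho>"
  shows "closedin \<tau> (\<rho> closure_of H)"
proof -
  have "openin (at_topology \<rho>) (topspace \<rho> - \<rho> closure_of H)"
    unfolding at_topology_def using assms by (intro topology_generated_by_Basis) auto
  then have "openin \<tau> (topspace \<tau> - \<rho> closure_of H)" "topspace \<tau> = topspace \<rho>"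
    using assms(1) by (auto simp: topology_interval_def)
  then show ?thesis
    by (simp add: closedin_def closure_of_subset_topspace)
qed

text \<open>The complement of \<open>C\<close> is an intersection of \<open>\<rho>\<close>-open sets, one of which misses \<open>x\<close> and
  with it the whole \<open>\<rho>\<close>-closure of \<open>x\<close>.\<close>

lemma closure_of_point_subset_closedin_interval:
  assumes \<tau>: "\<tau> \<in> topology_interval \<rho>" and C: "closedin \<tau> C" and x: "x \<in> C"
  shows "\<rho> closure_of {x} \<subseteq> C"
proof
  fix y assume y: "y \<in> \<rho> closure_of {x}"
  have top: "topspace \<tau> = topspace \<rho>"
    using \<tau> by (simp add: topology_interval_def)
  have "topspace \<tau> - C \<in> closure_in_cube \<rho>"
    using \<tau> C by (auto simp: topology_interval_def closedin_def)
  then obtain \<F> where \<F>: "\<And>U. U \<in> \<F> \<Longrightarrow> openin \<rho> U" "topspace \<tau> - C = \<Inter>\<F>"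
    unfolding closure_in_cube_eq_Inter by blast
  then obtain U where U: "U \<in> \<F>" "x \<notin> U"
    using x by blast
  then have "y \<notin> U"
    using y \<F>(1) by (auto simp: in_closure_of)
  then have "y \<notin> topspace \<tau> - C"
    using U(1) \<F>(2) by blast
  then show "y \<in> C"
    using y top by (auto simp: in_closure_of)
qed

lemma closure_of_point_interval:
  assumes \<tau>: "\<tau> \<in> topology_interval \<rho>" and x: "x \<in> topspace \<rho>"
  shows "\<tau> closure_of {x} = \<rho> closure_of {x}"
proof
  have "x \<in> \<rho> closure_of {x}"
    using x by (simp add: in_closure_of)
  then show "\<tau> closure_of {x} \<subseteq> \<rho> closure_of {x}"
    using closedin_closure_of_finite_interval[OF \<tau>, of "{x}"] x by (simp add: closure_of_minimal)
  have "x \<in> \<tau> closure_of {x}"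
    using \<tau> x by (simp add: in_closure_of topology_interval_def)
  then show "\<rho> closure_of {x} \<subseteq> \<tau> closure_of {x}"
    using closure_of_point_subset_closedin_interval[OF \<tau>] by simp
qed

text \<open>The upper bound of the interval is inherited from \<open>\<tau>\<close>, and the complements of the sets
  \<open>cl\<^sub>\<rho>(H)\<close> generate the lower bound.\<close>

lemma coarser_in_interval:
  assumes \<tau>: "\<tau> \<in> topology_interval \<rho>" and top: "topspace \<sigma> = topspace \<rho>"
    and coarser: "\<And>U. openin \<sigma> U \<Longrightarrow> openin \<tau> U"
    and closed: "\<And>H. finite H \<Longrightarrow> H \<subseteq> topspace \<rho> \<Longrightarrow> closedin \<sigma> (\<rho> closure_of H)"
  shows "\<sigma> \<in> topology_interval \<rho>"
proof -
  have "openin \<sigma> U" if "openin (at_topology \<rho>) U" for U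
    using that unfolding at_topology_def openin_topology_generated_by_iff
    by (rule generate_topology_on_coarsest[OF istopology_openin, rotated])
       (use closed top in \<open>auto simp: closedin_def\<close>)
  then show ?thesis
    using \<tau> top coarser unfolding topology_interval_def by blast
qed

lemma R0_closure_of_point_eq:
  assumes "R0_space \<rho>" "x \<in> topspace \<rho>" "y \<in> \<rho> closure_of {x}"
  shows "\<rho> closure_of {y} = \<rho> closure_of {x}"
proof -
  have y: "y \<in> topspace \<rho>"
    using assms(3) by (simp add: in_closure_of)
  then have "x \<in> \<rho> closure_of {y}"
    using assms by (simp add: R0_space_def)
  then show ?thesis
    using assms(3) by (intro subset_antisym closure_of_minimal) auto
qed

section \<open>Sets covered by finitely many point closures\<close>

definition finitely_covered :: "'a topology \<Rightarrow> 'a set \<Rightarrow> bool" where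
  "finitely_covered \<rho> A \<longleftrightarrow> (\<exists>H. finite H \<and> H \<subseteq> topspace \<rho> \<and> A \<subseteq> \<rho> closure_of H)"

lemma finitely_covered_subset:
  "finitely_covered \<rho> B \<Longrightarrow> A \<subseteq> B \<Longrightarrow> finitely_covered \<rho> A"
  unfolding finitely_covered_def by blast

lemma finitely_covered_closure_of:
  "finite H \<Longrightarrow> H \<subseteq> topspace \<rho> \<Longrightarrow> finitely_covered \<rho> (\<rho> closure_of H)"
  unfolding finitely_covered_def by blast

lemma finitely_covered_Un:
  assumes "finitely_covered \<rho> A" "finitely_covered \<rho> B"
  shows "finitely_covered \<rho> (A \<union> B)"
proof -
  obtain H K where "finite H" "H \<subseteq> topspace \<rho>" "A \<subseteq> \<rho> closure_of H"
    "finite K" "K \<subseteq> topspace \<rho>" "B \<subseteq> \<rho> closure_of K"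
    using assms unfolding finitely_covered_def by blast
  then show ?thesis
    unfolding finitely_covered_def
    by (intro exI[of _ "H \<union> K"]) (auto simp: closure_of_Un)
qed

text \<open>If finitely many points \<open>H\<close> were dense, every point closure would meet, and hence by \<open>R\<^sub>0\<close>
  equal, the closure of a point of \<open>H\<close>.\<close>

lemma R0_not_finitely_covered_topspace:
  assumes R0: "R0_space \<rho>" and inf: "infinite (point_closures \<rho>)"
  shows "\<not> finitely_covered \<rho> (topspace \<rho>)"
proof
  assume "finitely_covered \<rho> (topspace \<rho>)"
  then obtain H where H: "finite H" "H \<subseteq> topspace \<rho>" "topspace \<rho> \<subseteq> \<rho> closure_of H"
    unfolding finitely_covered_def by blast
  have "\<rho> closure_of H = (\<Union>h\<in>H. \<rho> closure_of {h})"
    using closure_of_Union[of "(\<lambda>h. {h}) ` H" \<rho>] H(1) by simp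
  then have "\<exists>h\<in>H. x \<in> \<rho> closure_of {h}" if "x \<in> topspace \<rho>" for x
    using H(3) that by blast
  then have "\<exists>h\<in>H. \<rho> closure_of {x} = \<rho> closure_of {h}" if "x \<in> topspace \<rho>" for x
    using that H(2) R0_closure_of_point_eq[OF R0] by (meson subsetD)
  then have "point_closures \<rho> \<subseteq> (\<lambda>h. \<rho> closure_of {h}) ` H"
    by (auto simp: point_closures_def)
  then show False
    using H(1) inf by (meson finite_surj)
qed

section \<open>Splitting closed sets\<close>

lemma not_irreducible_closedinE:
  assumes "closedin \<tau> C" "C \<noteq> {}" "\<not> irreducible_closedin \<tau> C"
  obtains C1 C2 where "closedin \<tau> C1" "closedin \<tau> C2" "C1 \<noteq> {}" "C2 \<noteq> {}"
    "C1 \<subset> C" "C2 \<subset> C" "C = C1 \<union> C2"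
  using assms unfolding irreducible_closedin_def by blast

lemma irreducible_closedin_Un:
  assumes "irreducible_closedin \<tau> (C1 \<union> C2)" "closedin \<tau> C1" "closedin \<tau> C2"
  shows "C1 \<union> C2 = C1 \<or> C1 \<union> C2 = C2"
  using assms unfolding irreducible_closedin_def by blast

text \<open>In a presober member of the interval the irreducible closed sets are single blocks.\<close>

lemma presober_not_finitely_covered_split:
  assumes \<tau>: "\<tau> \<in> topology_interval \<rho>" "presober \<tau>"
    and C: "closedin \<tau> C" "\<not> finitely_covered \<rho> C"
  obtains C1 C2 where "closedin \<tau> C1" "closedin \<tau> C2" "C1 \<subset> C" "C2 \<subset> C" "C = C1 \<union> C2"
proof -
  have top: "topspace \<tau> = topspace \<rho>"
    using \<tau> by (simp add: topology_interval_def)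
  have "C \<noteq> {}"
    using C(2) by (auto simp: finitely_covered_def)
  moreover have "\<not> irreducible_closedin \<tau> C"
  proof
    assume "irreducible_closedin \<tau> C"
    then obtain x where "x \<in> topspace \<rho>" "C = \<rho> closure_of {x}"
      using \<tau> top closure_of_point_interval unfolding presober_def by metis
    then show False
      using C(2) finitely_covered_closure_of[of "{x}"] by simp
  qed
  ultimately show ?thesis
    using not_irreducible_closedinE[OF C(1)] that by metis
qed

section \<open>The coarser topology\<close>

text \<open>In terms of closed sets: a \<open>\<tau>\<close>-closed set stays closed if it contains \<open>p\<close> or is finitely
  covered. If \<open>\<tau>\<close> and \<open>\<rho>\<close> are discrete this is the Fort topology with particular point \<open>p\<close>.\<close>

definition coarsen_at :: "'a topology \<Rightarrow> 'a topology \<Rightarrow> 'a \<Rightarrow> 'a topology" where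
  "coarsen_at \<rho> \<tau> p =
    topology (\<lambda>U. openin \<tau> U \<and> (p \<notin> U \<or> finitely_covered \<rho> (topspace \<tau> - U)))"

lemma openin_coarsen_at:
  "openin (coarsen_at \<rho> \<tau> p) U \<longleftrightarrow>
    openin \<tau> U \<and> (p \<notin> U \<or> finitely_covered \<rho> (topspace \<tau> - U))"
proof -
  have "istopology (\<lambda>U. openin \<tau> U \<and> (p \<notin> U \<or> finitely_covered \<rho> (topspace \<tau> - U)))"
    unfolding istopology_def
  proof (intro conjI allI impI)
    fix S T
    assume S: "openin \<tau> S \<and> (p \<notin> S \<or> finitely_covered \<rho> (topspace \<tau> - S))"
      and T: "openin \<tau> T \<and> (p \<notin> T \<or> finitely_covered \<rho> (topspace \<tau> - T))"
    show "openin \<tau> (S \<inter> T)"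
      using S T by blast
    show "p \<notin> S \<inter> T \<or> finitely_covered \<rho> (topspace \<tau> - S \<inter> T)"
      using S T by (auto simp: Diff_Int intro: finitely_covered_Un)
  next
    fix \<K>
    assume \<K>: "\<forall>K\<in>\<K>. openin \<tau> K \<and> (p \<notin> K \<or> finitely_covered \<rho> (topspace \<tau> - K))"
    show "openin \<tau> (\<Union>\<K>)"
      using \<K> by blast
    show "p \<notin> \<Union>\<K> \<or> finitely_covered \<rho> (topspace \<tau> - \<Union>\<K>)"
      using \<K> by (metis Diff_mono Union_iff Union_upper finitely_covered_subset subset_refl)
  qed
  then show ?thesis
    by (simp add: coarsen_at_def)
qed

lemma topspace_coarsen_at: "topspace (coarsen_at \<rho> \<tau> p) = topspace \<tau>"
proof -
  have "finitely_covered \<rho> {}"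
    by (auto simp: finitely_covered_def)
  then have "openin (coarsen_at \<rho> \<tau> p) (topspace \<tau>)"
    by (simp add: openin_coarsen_at)
  then show ?thesis
    by (meson openin_coarsen_at openin_subset openin_topspace subset_antisym)
qed

lemma closedin_coarsen_at:
  assumes "p \<in> topspace \<tau>"
  shows "closedin (coarsen_at \<rho> \<tau> p) C \<longleftrightarrow> closedin \<tau> C \<and> (p \<in> C \<or> finitely_covered \<rho> C)"
  using assms
  by (auto simp: closedin_def topspace_coarsen_at openin_coarsen_at double_diff)

lemma coarsen_at_in_interval:
  assumes "\<tau> \<in> topology_interval \<rho>" "p \<in> topspace \<rho>"
  shows "coarsen_at \<rho> \<tau> p \<in> topology_interval \<rho>"
proof (rule coarser_in_interval[OF assms(1)])
  have top: "topspace \<tau> = topspace \<rho>"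
    using assms(1) by (simp add: topology_interval_def)
  then show "topspace (coarsen_at \<rho> \<tau> p) = topspace \<rho>"
    by (simp add: topspace_coarsen_at)
  show "closedin (coarsen_at \<rho> \<tau> p) (\<rho> closure_of H)"
    if "finite H" "H \<subseteq> topspace \<rho>" for H
    using that assms top
    by (simp add: closedin_coarsen_at closedin_closure_of_finite_interval finitely_covered_closure_of)
qed (simp add: openin_coarsen_at)

text \<open>Let \<open>P\<close> be the block of \<open>p\<close>. A set that is irreducible in the coarser topology \<open>\<sigma>\<close> is
  irreducible in \<open>\<tau>\<close>, so that it has a generic point. Indeed a \<open>\<tau>\<close>-splitting of a finitely covered set is
  a \<open>\<sigma>\<close>-splitting. A \<open>\<tau>\<close>-splitting of a set \<open>C\<close> containing \<open>p\<close> becomes a \<open>\<sigma>\<close>-splitting by adding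
  \<open>P\<close> to both parts, unless one part is \<open>C - P\<close>. If \<open>C\<close> is not finitely covered then neither is
  \<open>C - P\<close>, so \<open>C - P\<close> has a \<open>\<tau>\<close>-splitting, to which \<open>P\<close> can be added.\<close>

lemma presober_coarsen_at:
  assumes R0: "R0_space \<rho>" and \<tau>: "\<tau> \<in> topology_interval \<rho>" "presober \<tau>"
    and p: "p \<in> topspace \<rho>"
  shows "presober (coarsen_at \<rho> \<tau> p)"
proof -
  define \<sigma> where "\<sigma> = coarsen_at \<rho> \<tau> p"
  define P where "P = \<rho> closure_of {p}"
  have top: "topspace \<tau> = topspace \<rho>"
    using \<tau> by (simp add: topology_interval_def)
  have \<sigma>_interval: "\<sigma> \<in> topology_interval \<rho>"
    unfolding \<sigma>_def by (rule coarsen_at_in_interval[OF \<tau>(1) p])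
  have closed_\<sigma>: "closedin \<sigma> D \<longleftrightarrow> closedin \<tau> D \<and> (p \<in> D \<or> finitely_covered \<rho> D)" for D
    unfolding \<sigma>_def using closedin_coarsen_at p top by metis
  have P: "p \<in> P" "closedin \<tau> P" "finitely_covered \<rho> P"
    using p closedin_closure_of_finite_interval[OF \<tau>(1), of "{p}"]
      finitely_covered_closure_of[of "{p}" \<rho>]
    by (auto simp: P_def in_closure_of)
  have closed_Un_P: "closedin \<sigma> (D \<union> P)" if "closedin \<tau> D" for D
    using that P by (simp add: closed_\<sigma> closedin_Un)
  have disjnt_P: "D \<inter> P = {}" if D: "closedin \<tau> D" "p \<notin> D" for D
  proof (rule ccontr)
    assume "D \<inter> P \<noteq> {}"
    then obtain y where y: "y \<in> D" "y \<in> P"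
      by blast
    then have "\<rho> closure_of {y} = P"
      unfolding P_def using R0_closure_of_point_eq[OF R0 p] by simp
    then show False
      using closure_of_point_subset_closedin_interval[OF \<tau>(1) D(1) y(1)] P(1) D(2) by blast
  qed

  have no_co_block: False
    if irr: "irreducible_closedin \<sigma> C" and C: "\<not> finitely_covered \<rho> C"
      and D: "closedin \<tau> D" "D \<subset> C" "D \<union> P = C" for C D
  proof -
    have "p \<notin> D"
      using D closure_of_point_subset_closedin_interval[OF \<tau>(1) D(1), of p] by (auto simp: P_def)
    then have DP: "D \<inter> P = {}"
      using D(1) disjnt_P by blast
    have "\<not> finitely_covered \<rho> D"
      using C D(3) P(3) finitely_covered_Un by blast
    then obtain D1 D2 where E: "closedin \<tau> D1" "closedin \<tau> D2" "D1 \<subset> D" "D2 \<subset> D" "D = D1 \<union> D2"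
      using presober_not_finitely_covered_split[OF \<tau> D(1)] by metis
    have "C = (D1 \<union> P) \<union> (D2 \<union> P)"
      using D(3) E(5) by blast
    then have "C = D1 \<union> P \<or> C = D2 \<union> P"
      using irreducible_closedin_Un[of \<sigma> "D1 \<union> P" "D2 \<union> P"] irr closed_Un_P E(1,2) by metis
    then show False
      using DP D(3) E(3,4) by blast
  qed

  have "irreducible_closedin \<tau> C" if irr: "irreducible_closedin \<sigma> C" for C
  proof (rule ccontr)
    assume red: "\<not> irreducible_closedin \<tau> C"
    have C: "closedin \<tau> C" "p \<in> C \<or> finitely_covered \<rho> C" "C \<noteq> {}"
      using irr closed_\<sigma> by (auto simp: irreducible_closedin_def)
    obtain C1 C2 where D: "closedin \<tau> C1" "closedin \<tau> C2" "C1 \<subset> C" "C2 \<subset> C" "C = C1 \<union> C2"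
      using not_irreducible_closedinE[OF C(1,3) red] by metis
    show False
    proof (cases "finitely_covered \<rho> C")
      case True
      then have "closedin \<sigma> C1" "closedin \<sigma> C2"
        using D finitely_covered_subset by (auto simp: closed_\<sigma>)
      then show False
        using irreducible_closedin_Un[of \<sigma> C1 C2] irr D by auto
    next
      case False
      then have "P \<subseteq> C"
        using C closure_of_point_subset_closedin_interval[OF \<tau>(1)] by (auto simp: P_def)
      then have "C = (C1 \<union> P) \<union> (C2 \<union> P)"
        using D(5) by blast
      then have "C1 \<union> P = C \<or> C2 \<union> P = C"
        using irreducible_closedin_Un[of \<sigma> "C1 \<union> P" "C2 \<union> P"] irr closed_Un_P D(1,2) by metis
      then show False
        using no_co_block[OF irr False] D by blast
    qed
  qed
  then have "\<exists>x\<in>topspace \<sigma>. C = \<sigma> closure_of {x}" if "irreducible_closedin \<sigma> C" for C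
    using that \<tau> top closure_of_point_interval[OF \<tau>(1)] closure_of_point_interval[OF \<sigma>_interval]
    unfolding presober_def \<sigma>_def topspace_coarsen_at by metis
  then show ?thesis
    unfolding presober_def \<sigma>_def by blast
qed

section \<open>No minimal presober topology\<close>

theorem proposition4p9:
  fixes X :: "'a set" and \<rho> :: "'a topology"
  assumes "topspace \<rho> = X"
    and "R0_space \<rho>"
    and "\<exists>\<C>. \<C> \<subseteq> point_closures \<rho> \<and> infinite \<C> \<and> disjoint \<C> \<and> \<Union>\<C> = X"
  shows "\<not> (\<exists>\<tau>\<in>topology_interval \<rho>. presober \<tau> \<and>
            \<not> (\<exists>\<sigma>\<in>topology_interval \<rho>.
                 {U. openin \<sigma> U} \<subset> {U. openin \<tau> U} \<and> presober \<sigma>))"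
proof -
  have "\<exists>\<sigma>\<in>topology_interval \<rho>. {U. openin \<sigma> U} \<subset> {U. openin \<tau> U} \<and> presober \<sigma>"
    if \<tau>: "\<tau> \<in> topology_interval \<rho>" "presober \<tau>" for \<tau>
  proof -
    have top: "topspace \<tau> = topspace \<rho>"
      using \<tau> by (simp add: topology_interval_def)
    have "infinite (point_closures \<rho>)"
      using assms(3) infinite_super by blast
    then have big: "\<not> finitely_covered \<rho> (topspace \<tau>)"
      using R0_not_finitely_covered_topspace[OF assms(2)] top by simp
    then obtain C1 C2 where "closedin \<tau> C1" "closedin \<tau> C2" "C1 \<subset> topspace \<tau>" "C2 \<subset> topspace \<tau>"
      "topspace \<tau> = C1 \<union> C2"
      using presober_not_finitely_covered_split[OF \<tau> closedin_topspace] by metis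
    then obtain C p where C: "closedin \<tau> C" "\<not> finitely_covered \<rho> C"
      and p: "p \<in> topspace \<tau>" "p \<notin> C"
      using finitely_covered_Un[of \<rho> C1 C2] big by (metis psubset_imp_ex_mem Diff_iff)
    let ?\<sigma> = "coarsen_at \<rho> \<tau> p"
    have "\<not> closedin ?\<sigma> C"
      using C p by (simp add: closedin_coarsen_at)
    then have "\<not> openin ?\<sigma> (topspace \<tau> - C)" "openin \<tau> (topspace \<tau> - C)"
      using C(1) by (auto simp: closedin_def topspace_coarsen_at)
    then have "{U. openin ?\<sigma> U} \<subset> {U. openin \<tau> U}"
      by (auto simp: openin_coarsen_at)
    then show ?thesis
      using coarsen_at_in_interval[OF \<tau>(1)] presober_coarsen_at[OF assms(2) \<tau>] p(1) top by metis
  qed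
  then show ?thesis
    by blast
qed

end
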